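(* For every integer $m\ge1$, with $I=[0,1]$, $$\int_{I^m}\Sigma t^{-1}\cdot\prod_{j=1}^m t_j^2(1-t_j)^2\,\Delta_m^4(t)\,dt=\frac{S_m(5,1,2)-S_m(3,3,2)}{2}$$ and $$\int_{I^m}\Sigma t^{-1}\cdot\prod_{j=1}^m t_j^2\cdot\Delta_m^4(t)\,dt=\frac{m}{2}\,S_{m-1}(5,3,2).$$
   Context: $\Sigma t^{-1}:=\sum_{j=1}^m t_j^{-1}$. $\Delta_m(t):=\prod_{1\le j<k\le m}(t_k-t_j)$, $\Delta_m^4(t)=(\Delta_m(t))^4$. $S_n(\alpha,\beta,\gamma)$ denotes the Selberg integral $$S_n(\alpha,\beta,\gamma):=\int_{I^n}\prod_{j=1}^nt_j^{\alpha-1}(1-t_j)^{\beta-1}\,|\Delta_n(t)|^{2\gamma}\,dt,$$ with $S_0:=1$. *)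

theory Defs
  imports "HOL-Analysis.Analysis"
begin

text \<open>
  Points of $\mathbb{R}^n$ are functions on the index set \<open>{1..n}\<close>, extended by
  \<open>undefined\<close> outside it, with the product Lebesgue measure; thus the dimension is an
  ordinary natural number. For \<open>n = 0\<close> the measure is the unit point mass.
\<close>

abbreviation lborel_pow :: "nat \<Rightarrow> (nat \<Rightarrow> real) measure" where
  "lborel_pow n \<equiv> \<Pi>\<^sub>M j\<in>{1..n}. lborel"

abbreviation unit_cube :: "nat \<Rightarrow> (nat \<Rightarrow> real) set" where
  "unit_cube n \<equiv> \<Pi>\<^sub>E j\<in>{1..n}. {0..1}"

definition vandermonde :: "nat \<Rightarrow> (nat \<Rightarrow> real) \<Rightarrow> real" where
  "vandermonde n t = (\<Prod>(j, k)\<in>{(j, k). 1 \<le> j \<and> j < k \<and> k \<le> n}. t k - t j)"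

definition sum_inverse :: "nat \<Rightarrow> (nat \<Rightarrow> real) \<Rightarrow> real" where
  "sum_inverse n t = (\<Sum>j=1..n. inverse (t j))"

text \<open>
  Since \<open>0 powr a = 0\<close> for every \<open>a\<close>, including \<open>a = 0\<close>, the integrand may differ from the
  usual one where some base vanishes, that is, where \<open>t j \<in> {0, 1}\<close> or \<open>t j = t k\<close>; this
  is a null set.
\<close>

definition selberg_integral :: "nat \<Rightarrow> real \<Rightarrow> real \<Rightarrow> real \<Rightarrow> real" where
  "selberg_integral n \<alpha> \<beta> \<gamma> =
     (LINT t:unit_cube n|lborel_pow n.
        (\<Prod>j=1..n. t j powr (\<alpha> - 1) * (1 - t j) powr (\<beta> - 1))
        * \<bar>vandermonde n t\<bar> powr (2 * \<gamma>))"

lemma selberg_integral_0: "selberg_integral 0 \<alpha> \<beta> \<gamma> = 1"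
proof -
  have "vandermonde 0 t = 1" for t
    unfolding vandermonde_def by (intro prod.neutral) auto
  then show ?thesis
    by (simp add: selberg_integral_def set_lebesgue_integral_def
        PiM_empty lebesgue_integral_count_space_finite)
qed

end

theory Submission
  imports Defs
begin

text \<open>
  Write \<open>\<langle>f\<rangle>\<close> for the integral of \<open>f(t) \<Prod> t\<^sub>j\<^sup>a (1 - t\<^sub>j)\<^sup>b \<Delta>\<^sup>4(t)\<close> over the unit cube, and \<open>S(a,b)\<close>
  for \<open>\<langle>1\<rangle>\<close>; this is the Selberg integral with parameters \<open>(a+1, b+1, 2)\<close>. Everything comes from
  one integration by parts. If \<open>q\<close> does not involve \<open>t\<^sub>i\<close>, the fundamental theorem of calculus in
  the direction \<open>t\<^sub>i\<close>, applied to \<open>p(t\<^sub>i) q(t) \<Delta>\<^sup>4(t)\<close>, produces the integrand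
  \<open>(p'(t\<^sub>i) + 4 p(t\<^sub>i) \<Sum>\<^sub>j 1/(t\<^sub>i - t\<^sub>j)) q(t) \<Delta>\<^sup>4(t)\<close> (\<open>loop_equation\<close>). The cube and \<open>\<Delta>\<^sup>4\<close> are
  invariant under exchanging \<open>t\<^sub>i\<close> and \<open>t\<^sub>j\<close>, while \<open>1/(t\<^sub>i - t\<^sub>j)\<close> changes sign; hence a factor \<open>h\<close>
  in front of it may be replaced by half the difference of \<open>h\<close> and its exchanged version, and that
  difference cancels the denominator (\<open>cube_integral_antisymmetrize\<close>).

  For the second identity take \<open>p = x\<^sup>2\<close> and let \<open>q\<close> be the product of the other squares. The
  interaction terms vanish by antisymmetry, \<open>p'\<close> gives twice the inverse moment of \<open>t\<^sub>i\<close>, and the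
  only boundary contribution is the face \<open>t\<^sub>i = 1\<close>, on which \<open>\<Delta>\<^sub>m\<^sup>4\<close> turns into
  \<open>\<Prod> (1 - t\<^sub>j)\<^sup>4 \<Delta>\<^sub>m\<^sub>-\<^sub>1\<^sup>4\<close>. This face integral is \<open>S(2,4)\<close> in dimension \<open>m - 1\<close>, which equals
  \<open>S(4,2)\<close> under \<open>t \<mapsto> 1 - t\<close>. All \<open>m\<close> coordinates contribute equally.

  For the first identity the choice \<open>p = x^(a+1) (1-x)^(b+1)\<close> has no boundary terms and gives Aomoto's
  recurrence between \<open>\<langle>\<Prod>k\<in>K. t\<^sub>k\<rangle>\<close> and the same average with one factor removed
  (\<open>aomoto_recurrence\<close>). With \<open>K\<close> the full index set and \<open>(a,b) = (1,2)\<close> it evaluates each inverse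
  moment for the weight with exponents \<open>(2,2)\<close>, so that the left-hand side is
  \<open>m(2m+3)/2 \<cdot> S(2,2)\<close>. Iterating the recurrence from the empty to the full set compares
  \<open>S(a+1,b)\<close> with \<open>S(a,b)\<close>. Climbing from \<open>S(2,0)\<close> to \<open>S(4,0)\<close>, and from \<open>S(0,2) = S(2,0)\<close> to
  \<open>S(2,2)\<close>, one meets the same denominators, and the quotient of the numerators telescopes:
  \<open>S(4,0) = (m+1)(2m+1) S(2,2)\<close>. Finally \<open>(m+1)(2m+1) - 1 = m(2m+3)\<close>.
\<close>

section \<open>Integrals of bounded functions over the cube\<close>

abbreviation cube_integral :: "'i set \<Rightarrow> (('i \<Rightarrow> real) \<Rightarrow> real) \<Rightarrow> real" where
  "cube_integral J f \<equiv> (LINT t:(\<Pi>\<^sub>E j\<in>J. {0..1})|(\<Pi>\<^sub>M j\<in>J. lborel). f t)"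

text \<open>
  All integrands below are built from polynomials and quotients \<open>\<Delta>\<^sup>4/(t\<^sub>i - t\<^sub>j)\<close>. Measurability and
  boundedness can be read off from such expressions, quotients included, are preserved by the ring
  operations, and give integrability over the cube.
\<close>

definition cube_bounded :: "'i set \<Rightarrow> (('i \<Rightarrow> real) \<Rightarrow> real) \<Rightarrow> bool" where
  "cube_bounded J f \<longleftrightarrow> f \<in> borel_measurable (\<Pi>\<^sub>M j\<in>J. lborel) \<and>
     (\<exists>C. \<forall>t\<in>(\<Pi>\<^sub>E j\<in>J. {0..1}). \<bar>f t\<bar> \<le> C)"

lemma cube_boundedI:
  assumes "f \<in> borel_measurable (\<Pi>\<^sub>M j\<in>J. lborel)"
    and "\<And>t. t \<in> (\<Pi>\<^sub>E j\<in>J. {0..1}) \<Longrightarrow> \<bar>f t\<bar> \<le> C"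
  shows "cube_bounded J f"
  using assms unfolding cube_bounded_def by blast

lemma cube_boundedE:
  assumes "cube_bounded J f"
  obtains C where "\<And>t. t \<in> (\<Pi>\<^sub>E j\<in>J. {0..1}) \<Longrightarrow> \<bar>f t\<bar> \<le> C" "C \<ge> 0"
proof -
  obtain C where C: "\<forall>t\<in>(\<Pi>\<^sub>E j\<in>J. {0..1}). \<bar>f t\<bar> \<le> C"
    using assms unfolding cube_bounded_def by blast
  show thesis
    by (rule that[of "\<bar>C\<bar>"]) (use C in force)+
qed

lemma cube_bounded_measurable:
  "cube_bounded J f \<Longrightarrow> f \<in> borel_measurable (\<Pi>\<^sub>M j\<in>J. lborel)"
  unfolding cube_bounded_def by blast

named_theorems cube_bounded_intros

lemma cube_bounded_const [cube_bounded_intros]: "cube_bounded J (\<lambda>_. c)"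
  by (rule cube_boundedI[of _ _ "\<bar>c\<bar>"]) auto

lemma cube_bounded_continuous [cube_bounded_intros]:
  assumes "j \<in> J" "continuous_on UNIV f"
  shows "cube_bounded J (\<lambda>t. f (t j))"
proof -
  have "compact (f ` {0..1})"
    by (intro compact_continuous_image continuous_on_subset[OF assms(2)]) auto
  then have "bounded (f ` {0..1})"
    by (rule compact_imp_bounded)
  then obtain C where C: "\<And>x. x \<in> {0..1} \<Longrightarrow> \<bar>f x\<bar> \<le> C"
    unfolding bounded_iff by (metis image_eqI real_norm_def)
  have "f \<in> borel_measurable borel"
    using assms(2) by (rule borel_measurable_continuous_onI)
  then show ?thesis
    using assms(1) by (intro cube_boundedI[of _ _ C] C PiE_mem[of _ J "\<lambda>_. {0..1}"]) auto
qed

lemma cube_bounded_add [cube_bounded_intros]: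
  assumes "cube_bounded J f" "cube_bounded J g"
  shows "cube_bounded J (\<lambda>t. f t + g t)"
proof -
  note [measurable] = assms[THEN cube_bounded_measurable]
  obtain C D where "\<And>t. t \<in> (\<Pi>\<^sub>E j\<in>J. {0..1}) \<Longrightarrow> \<bar>f t\<bar> \<le> C"
    "\<And>t. t \<in> (\<Pi>\<^sub>E j\<in>J. {0..1}) \<Longrightarrow> \<bar>g t\<bar> \<le> D"
    using assms by (metis cube_boundedE)
  then show ?thesis
    by (intro cube_boundedI[of _ _ "C + D"]) (measurable, smt (verit))
qed

lemma cube_bounded_mult [cube_bounded_intros]:
  assumes "cube_bounded J f" "cube_bounded J g"
  shows "cube_bounded J (\<lambda>t. f t * g t)"
proof -
  note [measurable] = assms[THEN cube_bounded_measurable]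
  obtain C D where "\<And>t. t \<in> (\<Pi>\<^sub>E j\<in>J. {0..1}) \<Longrightarrow> \<bar>f t\<bar> \<le> C" "C \<ge> 0"
    "\<And>t. t \<in> (\<Pi>\<^sub>E j\<in>J. {0..1}) \<Longrightarrow> \<bar>g t\<bar> \<le> D"
    using assms by (metis cube_boundedE)
  then show ?thesis
    by (intro cube_boundedI[of _ _ "C * D"]) (measurable, simp add: abs_mult mult_mono)
qed

lemma cube_bounded_diff [cube_bounded_intros]:
  assumes "cube_bounded J f" "cube_bounded J g"
  shows "cube_bounded J (\<lambda>t. f t - g t)"
  using cube_bounded_add[OF assms(1) cube_bounded_mult[OF cube_bounded_const[of J "-1"] assms(2)]]
  by simp

lemma cube_bounded_sum [cube_bounded_intros]:
  "(\<And>k. k \<in> K \<Longrightarrow> cube_bounded J (f k)) \<Longrightarrow> cube_bounded J (\<lambda>t. \<Sum>k\<in>K. f k t)"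
  by (induction K rule: infinite_finite_induct) (auto intro!: cube_bounded_intros)

lemma cube_bounded_prod [cube_bounded_intros]:
  "(\<And>k. k \<in> K \<Longrightarrow> cube_bounded J (f k)) \<Longrightarrow> cube_bounded J (\<lambda>t. \<Prod>k\<in>K. f k t)"
  by (induction K rule: infinite_finite_induct) (auto intro!: cube_bounded_intros)

lemma cube_bounded_power [cube_bounded_intros]:
  "cube_bounded J f \<Longrightarrow> cube_bounded J (\<lambda>t. f t ^ n)"
  by (induction n) (auto intro!: cube_bounded_intros)

lemma cube_bounded_component [cube_bounded_intros]:
  "j \<in> J \<Longrightarrow> cube_bounded J (\<lambda>t. t j)"
  by (rule cube_bounded_continuous) auto

lemma product_sigma_finite_lborel: "product_sigma_finite (\<lambda>_. lborel :: real measure)"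
  by (simp add: product_sigma_finite_def sigma_finite_lborel)

lemma sets_cube [measurable]:
  "finite J \<Longrightarrow> (\<Pi>\<^sub>E j\<in>J. {0..1::real}) \<in> sets (\<Pi>\<^sub>M j\<in>J. lborel)"
  by (intro sets_PiM_I_finite) auto

lemma cube_bounded_integrable:
  assumes "finite J" "cube_bounded J f"
  shows "set_integrable (\<Pi>\<^sub>M j\<in>J. lborel) (\<Pi>\<^sub>E j\<in>J. {0..1}) f"
proof -
  interpret product_sigma_finite "\<lambda>_. lborel :: real measure"
    by (rule product_sigma_finite_lborel)
  obtain C where C: "\<And>t. t \<in> (\<Pi>\<^sub>E j\<in>J. {0..1}) \<Longrightarrow> \<bar>f t\<bar> \<le> C"
    using assms(2) by (metis cube_boundedE)
  have "emeasure (\<Pi>\<^sub>M j\<in>J. lborel) (\<Pi>\<^sub>E j\<in>J. {0..1::real}) < \<infinity>"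
    using assms(1) by (subst emeasure_PiM) auto
  moreover have [measurable]: "f \<in> borel_measurable (\<Pi>\<^sub>M j\<in>J. lborel)"
    using assms(2) by (rule cube_bounded_measurable)
  ultimately show ?thesis
    unfolding set_integrable_def using assms(1) C
    by (intro integrableI_bounded_set_indicator[where B=C]) auto
qed

lemma cube_integral_cong:
  assumes "\<And>t. t \<in> (\<Pi>\<^sub>E j\<in>J. {0..1}) \<Longrightarrow> f t = g t"
  shows "cube_integral J f = cube_integral J g"
  using assms unfolding set_lebesgue_integral_def
  by (intro Bochner_Integration.integral_cong) (auto split: split_indicator)

lemma cube_integral_add:
  "\<lbrakk>finite J; cube_bounded J f; cube_bounded J g\<rbrakk> \<Longrightarrow>
   cube_integral J (\<lambda>t. f t + g t) = cube_integral J f + cube_integral J g"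
  by (intro set_integral_add cube_bounded_integrable)

lemma cube_integral_diff:
  "\<lbrakk>finite J; cube_bounded J f; cube_bounded J g\<rbrakk> \<Longrightarrow>
   cube_integral J (\<lambda>t. f t - g t) = cube_integral J f - cube_integral J g"
  by (intro set_integral_diff cube_bounded_integrable)

lemma cube_integral_sum:
  assumes "finite J" "finite K" "\<And>k. k \<in> K \<Longrightarrow> cube_bounded J (f k)"
  shows "cube_integral J (\<lambda>t. \<Sum>k\<in>K. f k t) = (\<Sum>k\<in>K. cube_integral J (f k))"
  using assms(2,3)
proof (induction K rule: finite_induct)
  case empty
  show ?case by (simp add: set_lebesgue_integral_def)
next
  case (insert k K)
  then show ?case
    using assms(1) by (simp add: cube_integral_add cube_bounded_sum)
qed

section \<open>Symmetries of the cube\<close>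

text \<open>
  Coordinate permutations and the reflection \<open>t \<mapsto> 1 - t\<close> are treated together: a map that permutes
  the coordinates and applies a measure-preserving \<open>\<phi>\<close> to each of them sends boxes to boxes of the
  same volume, and the product measure is determined by its values on boxes.
\<close>

lemma distr_PiM_lborel:
  fixes \<phi> :: "real \<Rightarrow> real"
  assumes J: "finite J" and p: "bij_betw p J J" and [measurable]: "\<phi> \<in> borel_measurable borel"
    and \<phi>: "distr lborel lborel \<phi> = lborel"
  shows "distr (\<Pi>\<^sub>M j\<in>J. lborel) (\<Pi>\<^sub>M j\<in>J. lborel) (\<lambda>t. \<lambda>j\<in>J. \<phi> (t (p j)))
       = (\<Pi>\<^sub>M j\<in>J. lborel)"
proof -
  interpret product_sigma_finite "\<lambda>_. lborel :: real measure"
    by (rule product_sigma_finite_lborel)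
  let ?M = "\<Pi>\<^sub>M j\<in>J. (lborel :: real measure)"
  have pJ: "p j \<in> J" if "j \<in> J" for j
    using p that by (auto simp: bij_betw_def)
  have T [measurable]: "(\<lambda>t. \<lambda>j\<in>J. \<phi> (t (p j))) \<in> measurable ?M ?M"
    using pJ by (intro measurable_restrict) measurable
  show ?thesis
  proof (rule PiM_eqI)
    fix A :: "'a \<Rightarrow> real set"
    assume A: "\<And>j. j \<in> J \<Longrightarrow> A j \<in> sets lborel"
    let ?q = "the_inv_into J p"
    have q: "?q j \<in> J" "p (?q j) = j" if "j \<in> J" for j
      using p that by (auto simp: bij_betw_def the_inv_into_into f_the_inv_into_f)
    have qp: "?q (p j) = j" if "j \<in> J" for j
      using p that by (auto simp: bij_betw_def the_inv_into_f_f)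
    have m: "\<phi> -` A (?q j) \<in> sets lborel" if "j \<in> J" for j
      using measurable_sets[of \<phi> lborel borel "A (?q j)"] A[OF q(1)[OF that]] by simp
    have "(\<lambda>t. \<lambda>j\<in>J. \<phi> (t (p j))) -` (Pi\<^sub>E J A) \<inter> space ?M = (\<Pi>\<^sub>E j\<in>J. \<phi> -` A (?q j))"
      (is "?L = ?R")
    proof (intro set_eqI iffI)
      fix t assume t: "t \<in> ?L"
      then have "\<phi> (t (p j)) \<in> A j" if "j \<in> J" for j
        using that by (auto simp: PiE_iff)
      from this[OF q(1)] show "t \<in> ?R"
        using t q by (auto simp: space_PiM PiE_iff)
    next
      fix t assume "t \<in> ?R"
      then show "t \<in> ?L"
        using pJ qp by (auto simp: space_PiM PiE_iff) metis
    qed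
    then have "emeasure (distr ?M ?M (\<lambda>t. \<lambda>j\<in>J. \<phi> (t (p j)))) (Pi\<^sub>E J A)
        = emeasure ?M (\<Pi>\<^sub>E j\<in>J. \<phi> -` A (?q j))"
      using A J by (subst emeasure_distr) (auto intro!: sets_PiM_I_finite)
    also have "\<dots> = (\<Prod>j\<in>J. emeasure lborel (\<phi> -` A (?q j)))"
      using m J by (subst emeasure_PiM) auto
    also have "\<dots> = (\<Prod>j\<in>J. emeasure lborel (A (?q j)))"
    proof (rule prod.cong)
      fix j assume "j \<in> J"
      then show "emeasure lborel (\<phi> -` A (?q j)) = emeasure lborel (A (?q j))"
        using A[OF q(1)] by (subst (2) \<phi>[symmetric], subst emeasure_distr) auto
    qed simp
    also have "\<dots> = (\<Prod>j\<in>J. emeasure lborel (A j))"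
      using prod.reindex_bij_betw[OF bij_betw_the_inv_into[OF p], of "\<lambda>j. emeasure lborel (A j)"] .
    finally show "emeasure (distr ?M ?M (\<lambda>t. \<lambda>j\<in>J. \<phi> (t (p j)))) (Pi\<^sub>E J A)
        = (\<Prod>j\<in>J. emeasure lborel (A j))" .
  qed (use J in simp_all)
qed

lemma cube_integral_transform:
  fixes \<phi> :: "real \<Rightarrow> real"
  assumes J: "finite J" and p: "bij_betw p J J" and [measurable]: "\<phi> \<in> borel_measurable borel"
    and \<phi>: "distr lborel lborel \<phi> = lborel" "\<And>x. \<phi> x \<in> {0..1} \<longleftrightarrow> x \<in> {0..1}"
    and f: "f \<in> borel_measurable (\<Pi>\<^sub>M j\<in>J. lborel)"
  shows "cube_integral J (\<lambda>t. f (\<lambda>j\<in>J. \<phi> (t (p j)))) = cube_integral J f"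
proof -
  let ?M = "\<Pi>\<^sub>M j\<in>J. (lborel :: real measure)"
  let ?T = "\<lambda>t. \<lambda>j\<in>J. \<phi> (t (p j))"
  have pJ: "p ` J = J"
    using p by (auto simp: bij_betw_def)
  have T [measurable]: "?T \<in> measurable ?M ?M"
    using pJ
    by (intro measurable_restrict)
       (auto intro!: measurable_compose[OF measurable_component_singleton] simp: assms(3))
  have T_cube: "?T t \<in> (\<Pi>\<^sub>E j\<in>J. {0..1}) \<longleftrightarrow> t \<in> (\<Pi>\<^sub>E j\<in>J. {0..1})" if "t \<in> space ?M" for t
  proof -
    have "(\<forall>j\<in>J. \<phi> (t (p j)) \<in> {0..1}) \<longleftrightarrow> (\<forall>j\<in>p ` J. t j \<in> {0..1})"
      using \<phi>(2) by simp
    with that pJ show ?thesis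
      by (simp add: space_PiM PiE_iff)
  qed
  have "cube_integral J f = (\<integral>t. indicator (\<Pi>\<^sub>E j\<in>J. {0..1}) t *\<^sub>R f t \<partial>distr ?M ?M ?T)"
    using distr_PiM_lborel[OF J p assms(3) \<phi>(1)] by (simp add: set_lebesgue_integral_def)
  also have "\<dots> = (\<integral>t. indicator (\<Pi>\<^sub>E j\<in>J. {0..1}) (?T t) *\<^sub>R f (?T t) \<partial>?M)"
    using f J by (intro integral_distr T borel_measurable_scaleR borel_measurable_indicator sets_cube)
  also have "\<dots> = cube_integral J (\<lambda>t. f (?T t))"
    unfolding set_lebesgue_integral_def using T_cube
    by (intro Bochner_Integration.integral_cong) (auto split: split_indicator)
  finally show ?thesis ..
qed

definition swap_coords :: "'i set \<Rightarrow> 'i \<Rightarrow> 'i \<Rightarrow> ('i \<Rightarrow> real) \<Rightarrow> 'i \<Rightarrow> real" where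
  "swap_coords J i j t = (\<lambda>k\<in>J. t (Transposition.transpose i j k))"

lemma bij_betw_transpose:
  "\<lbrakk>i \<in> J; j \<in> J\<rbrakk> \<Longrightarrow> bij_betw (Transposition.transpose i j) J J"
  by (rule bij_betw_byWitness[where f'="Transposition.transpose i j"])
     (auto simp: Transposition.transpose_def)

lemma cube_integral_swap:
  assumes "finite J" "i \<in> J" "j \<in> J" "f \<in> borel_measurable (\<Pi>\<^sub>M j\<in>J. lborel)"
  shows "cube_integral J (\<lambda>t. f (swap_coords J i j t)) = cube_integral J f"
  unfolding swap_coords_def using assms bij_betw_transpose
  by (intro cube_integral_transform[where \<phi>="\<lambda>x. x"]) (auto simp: distr_id2)

lemma cube_bounded_swap:
  assumes "i \<in> J" "j \<in> J" "cube_bounded J f"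
  shows "cube_bounded J (\<lambda>t. f (swap_coords J i j t))"
proof -
  have T: "Transposition.transpose i j k \<in> J" if "k \<in> J" for k
    using that assms by (auto simp: Transposition.transpose_def)
  obtain C where C: "\<And>t. t \<in> (\<Pi>\<^sub>E j\<in>J. {0..1}) \<Longrightarrow> \<bar>f t\<bar> \<le> C"
    using assms(3) by (metis cube_boundedE)
  show ?thesis
  proof (rule cube_boundedI)
    have "swap_coords J i j \<in> measurable (\<Pi>\<^sub>M j\<in>J. lborel) (\<Pi>\<^sub>M j\<in>J. lborel)"
      unfolding swap_coords_def using T
      by (intro measurable_restrict measurable_component_singleton)
    then show "(\<lambda>t. f (swap_coords J i j t)) \<in> borel_measurable (\<Pi>\<^sub>M j\<in>J. lborel)"
      using cube_bounded_measurable[OF assms(3)] by measurable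
    show "\<bar>f (swap_coords J i j t)\<bar> \<le> C" if "t \<in> (\<Pi>\<^sub>E j\<in>J. {0..1})" for t
      using that T by (intro C) (auto simp: swap_coords_def PiE_iff)
  qed
qed

lemma cube_integral_reflect:
  assumes "finite J" "f \<in> borel_measurable (\<Pi>\<^sub>M j\<in>J. lborel)"
  shows "cube_integral J (\<lambda>t. f (\<lambda>k\<in>J. 1 - t k)) = cube_integral J f"
proof -
  have "distr lborel lborel (\<lambda>x::real. 1 - x) = distr lborel borel (\<lambda>x. 1 - x)"
    by (rule distr_cong) simp_all
  also have "\<dots> = lborel"
    using lborel_real_affine[of "-1" 1, symmetric] by (simp add: density_1)
  finally show ?thesis
    using assms by (intro cube_integral_transform[where p="\<lambda>x. x"]) (auto simp: bij_betw_def)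
qed

section \<open>Integration by parts in one variable\<close>

text \<open>
  Fubini's theorem isolates the \<open>i\<close>-th coordinate, and the inner integral is evaluated by the
  fundamental theorem of calculus. Since \<open>g\<close> is only known to be measurable and bounded, the theorem
  is used for the Henstock-Kurzweil integral, which for such functions is the Lebesgue integral.
\<close>

lemma cube_integral_partial_derivative:
  assumes J: "finite J" "i \<notin> J" and g: "cube_bounded (insert i J) g"
    and deriv: "\<And>t x. ((\<lambda>x. f (t(i := x))) has_real_derivative g (t(i := x))) (at x)"
  shows "cube_integral (insert i J) g = cube_integral J (\<lambda>t. f (t(i := 1)) - f (t(i := 0)))"
proof -
  interpret product_sigma_finite "\<lambda>_. lborel :: real measure"
    by (rule product_sigma_finite_lborel)
  note [measurable] = cube_bounded_measurable[OF g]
  obtain C where C: "\<And>t. t \<in> (\<Pi>\<^sub>E j\<in>insert i J. {0..1}) \<Longrightarrow> \<bar>g t\<bar> \<le> C"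
    using g by (metis cube_boundedE)
  let ?ind = "\<lambda>J t. indicator (\<Pi>\<^sub>E j\<in>J. {0..1::real}) t :: real"
  have "cube_integral (insert i J) g
      = (\<integral>t. (\<integral>x. ?ind (insert i J) (t(i := x)) *\<^sub>R g (t(i := x)) \<partial>lborel) \<partial>(\<Pi>\<^sub>M j\<in>J. lborel))"
    unfolding set_lebesgue_integral_def using cube_bounded_integrable[OF _ g] J
    by (subst product_integral_insert) (auto simp: set_integrable_def)
  also have "\<dots> = cube_integral J (\<lambda>t. f (t(i := 1)) - f (t(i := 0)))"
    unfolding set_lebesgue_integral_def
  proof (rule Bochner_Integration.integral_cong)
    fix t assume t: "t \<in> space (\<Pi>\<^sub>M j\<in>J. (lborel :: real measure))"
    have ind: "?ind (insert i J) (t(i := x)) = ?ind J t * indicator {0..1} x" for x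
    proof -
      have "t(i := x) \<in> (\<Pi>\<^sub>E j\<in>insert i J. {0..1}) \<longleftrightarrow> t \<in> (\<Pi>\<^sub>E j\<in>J. {0..1}) \<and> x \<in> {0..1}"
        using t J by (auto simp: space_PiM PiE_iff extensional_def)
      then show ?thesis by (auto split: split_indicator)
    qed
    show "(\<integral>x. ?ind (insert i J) (t(i := x)) *\<^sub>R g (t(i := x)) \<partial>lborel)
        = ?ind J t *\<^sub>R (f (t(i := 1)) - f (t(i := 0)))"
    proof (cases "t \<in> (\<Pi>\<^sub>E j\<in>J. {0..1})")
      case True
      have "(\<lambda>x. t(i := x)) \<in> measurable lborel (\<Pi>\<^sub>M j\<in>insert i J. lborel)"
        using t by (intro measurable_PiM_single') (auto simp: space_PiM PiE_iff extensional_def)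
      then have m: "(\<lambda>x. g (t(i := x))) \<in> borel_measurable lborel"
        by measurable
      have "set_integrable lborel {0..1} (\<lambda>x. g (t(i := x)))"
        unfolding set_integrable_def
      proof (rule integrableI_bounded_set_indicator[where B=C])
        show "AE x in lborel. x \<in> {0..1} \<longrightarrow> norm (g (t(i := x))) \<le> C"
          using C True by (intro AE_I2) (auto simp: PiE_iff extensional_def)
      qed (use m in auto)
      then have "(LINT x:{0..1}|lborel. g (t(i := x))) = integral {0..1} (\<lambda>x. g (t(i := x)))"
        by (rule set_borel_integral_eq_integral)
      also have "\<dots> = f (t(i := 1)) - f (t(i := 0))"
        using has_field_derivative_at_within[OF deriv]
        unfolding has_real_derivative_iff_has_vector_derivative
        by (intro integral_unique fundamental_theorem_of_calculus) simp
      finally show ?thesis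
        using True by (simp add: ind set_lebesgue_integral_def)
    next
      case False
      then show ?thesis by (simp add: ind)
    qed
  qed simp
  finally show ?thesis .
qed

text \<open>
  The fourth power of the Vandermonde product for an arbitrary index set: running over ordered pairs
  doubles the exponent 2, and makes both the invariance under permutations and the removal of one
  index visible without an order on the indices.
\<close>

definition vandermonde4 :: "'i set \<Rightarrow> ('i \<Rightarrow> real) \<Rightarrow> real" where
  "vandermonde4 J t = (\<Prod>j\<in>J. \<Prod>k\<in>J - {j}. (t k - t j)\<^sup>2)"

lemma vandermonde4_cong:
  "(\<And>j. j \<in> J \<Longrightarrow> t j = s j) \<Longrightarrow> vandermonde4 J t = vandermonde4 J s"
  unfolding vandermonde4_def by (intro prod.cong) auto

lemma vandermonde4_insert:
  assumes "finite J" "i \<notin> J"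
  shows "vandermonde4 (insert i J) t = vandermonde4 J t * (\<Prod>j\<in>J. (t i - t j) ^ 4)"
proof -
  have row: "(\<Prod>k\<in>insert i J - {j}. (t k - t j)\<^sup>2) = (t i - t j)\<^sup>2 * (\<Prod>k\<in>J - {j}. (t k - t j)\<^sup>2)"
    if "j \<in> J" for j
  proof -
    have "insert i J - {j} = insert i (J - {j})"
      using that assms by auto
    then show ?thesis
      using assms by simp
  qed
  have "vandermonde4 (insert i J) t
      = (\<Prod>k\<in>J. (t k - t i)\<^sup>2) * (\<Prod>j\<in>J. \<Prod>k\<in>insert i J - {j}. (t k - t j)\<^sup>2)"
    unfolding vandermonde4_def using assms by simp
  also have "\<dots> = (\<Prod>k\<in>J. (t i - t k)\<^sup>2) * (\<Prod>j\<in>J. (t i - t j)\<^sup>2 * (\<Prod>k\<in>J - {j}. (t k - t j)\<^sup>2))"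
    using row by (simp add: power2_commute[of "t i"])
  also have "\<dots> = vandermonde4 J t * (\<Prod>j\<in>J. (t i - t j) ^ 4)"
  proof -
    have "(t i - t j) ^ 4 = (t i - t j)\<^sup>2 * (t i - t j)\<^sup>2" for j
      by (simp flip: power_add)
    then show ?thesis
      unfolding vandermonde4_def by (simp only: prod.distrib mult_ac)
  qed
  finally show ?thesis .
qed

lemma vandermonde_Suc:
  "vandermonde (Suc n) t = vandermonde n t * (\<Prod>j=1..n. t (Suc n) - t j)"
proof -
  let ?P = "\<lambda>n. {(j, k). 1 \<le> j \<and> j < k \<and> k \<le> n}"
  have fin: "finite (?P n)"
    by (rule finite_subset[of _ "{..n} \<times> {..n}"]) auto
  have "?P (Suc n) = ?P n \<union> (\<lambda>j. (j, Suc n)) ` {1..n}"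
    by auto
  moreover have "?P n \<inter> (\<lambda>j. (j, Suc n)) ` {1..n} = {}"
    by auto
  ultimately show ?thesis
    unfolding vandermonde_def using fin
    by (simp add: prod.union_disjoint prod.reindex inj_on_def)
qed

lemma vandermonde_power4: "vandermonde n t ^ 4 = vandermonde4 {1..n} t"
proof (induction n)
  case 0
  have "vandermonde 0 t = 1"
    unfolding vandermonde_def by (intro prod.neutral) auto
  then show ?case by (simp add: vandermonde4_def)
next
  case (Suc n)
  have "vandermonde4 {1..Suc n} t = vandermonde4 (insert (Suc n) {1..n}) t"
    by (simp add: atLeastAtMostSuc_conv)
  then show ?case
    using Suc by (simp add: vandermonde_Suc vandermonde4_insert power_mult_distrib prod_power_distrib)
qed

lemma vandermonde4_eq_0:
  assumes "finite J" "i \<in> J" "j \<in> J" "i \<noteq> j" "t i = t j"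
  shows "vandermonde4 J t = 0"
proof -
  have "(\<Prod>k\<in>J - {i}. (t k - t i)\<^sup>2) = 0"
    using assms by (intro prod_zero bexI[of _ j]) auto
  with assms(1,2) show ?thesis
    unfolding vandermonde4_def by (intro prod_zero) blast+
qed

lemma vandermonde4_permute:
  assumes p: "bij_betw p J J"
  shows "vandermonde4 J (\<lambda>k\<in>J. t (p k)) = vandermonde4 J t"
proof -
  have "vandermonde4 J (\<lambda>k\<in>J. t (p k)) = (\<Prod>j\<in>J. \<Prod>k\<in>J - {j}. (t (p k) - t (p j))\<^sup>2)"
    unfolding vandermonde4_def by (intro prod.cong) auto
  also have "\<dots> = (\<Prod>j\<in>J. \<Prod>k\<in>J - {p j}. (t k - t (p j))\<^sup>2)"
  proof (rule prod.cong)
    fix j assume "j \<in> J"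
    then have "bij_betw p (J - {j}) (J - {p j})"
      using p by (intro bij_betw_DiffI) (auto simp: bij_betw_def)
    from prod.reindex_bij_betw[OF this, of "\<lambda>k. (t k - t (p j))\<^sup>2"]
    show "(\<Prod>k\<in>J - {j}. (t (p k) - t (p j))\<^sup>2) = (\<Prod>k\<in>J - {p j}. (t k - t (p j))\<^sup>2)" .
  qed simp
  also have "\<dots> = vandermonde4 J t"
    unfolding vandermonde4_def
    using prod.reindex_bij_betw[OF p, of "\<lambda>j. \<Prod>k\<in>J - {j}. (t k - t j)\<^sup>2"] .
  finally show ?thesis .
qed

lemma cube_bounded_vandermonde4 [cube_bounded_intros]:
  "J \<subseteq> I \<Longrightarrow> cube_bounded I (vandermonde4 J)"
  unfolding vandermonde4_def by (intro cube_bounded_intros) auto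

text \<open>
  The factors \<open>(t\<^sub>k - t\<^sub>l)\<^sup>2\<close> are at most 1 on the cube, and one of them is \<open>(t\<^sub>i - t\<^sub>j)\<^sup>2\<close>, which
  absorbs the denominator.
\<close>

lemma cube_bounded_vandermonde4_quotient [cube_bounded_intros]:
  assumes J: "finite J" and i: "i \<in> J" and j: "j \<in> J" "i \<noteq> j" and h: "cube_bounded J h"
  shows "cube_bounded J (\<lambda>t. h t * vandermonde4 J t / (t i - t j))"
proof -
  have "cube_bounded J (\<lambda>t. vandermonde4 J t / (t i - t j))"
  proof (rule cube_boundedI[of _ _ 1])
    have [measurable]: "vandermonde4 J \<in> borel_measurable (\<Pi>\<^sub>M j\<in>J. lborel)"
      by (intro cube_bounded_measurable cube_bounded_intros) simp
    show "(\<lambda>t. vandermonde4 J t / (t i - t j)) \<in> borel_measurable (\<Pi>\<^sub>M j\<in>J. lborel)"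
      using i j by measurable
  next
    fix t :: "'a \<Rightarrow> real" assume "t \<in> (\<Pi>\<^sub>E j\<in>J. {0..1})"
    then have t01: "t k \<in> {0..1}" if "k \<in> J" for k
      using that by (simp add: PiE_iff)
    have t: "\<bar>t k - t l\<bar> \<le> 1" if "k \<in> J" "l \<in> J" for k l
      using t01[of k] t01[of l] that by auto
    have sq: "0 \<le> (t k - t l)\<^sup>2" "(t k - t l)\<^sup>2 \<le> 1" if "k \<in> J" "l \<in> J" for k l
      using t[OF that] by (auto simp: abs_square_le_1)
    let ?d = "\<bar>t i - t j\<bar>"
    have "vandermonde4 J t = (\<Prod>k\<in>J - {i}. (t k - t i)\<^sup>2) * (\<Prod>l\<in>J - {i}. \<Prod>k\<in>J - {l}. (t k - t l)\<^sup>2)"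
      unfolding vandermonde4_def using J i by (subst prod.remove[of J i]) auto
    also have "\<dots> \<le> (t j - t i)\<^sup>2 * 1"
    proof (rule mult_mono)
      have "(\<Prod>k\<in>J - {i}. (t k - t i)\<^sup>2) = (t j - t i)\<^sup>2 * (\<Prod>k\<in>J - {i} - {j}. (t k - t i)\<^sup>2)"
        using J i j by (subst prod.remove[of _ j]) auto
      also have "\<dots> \<le> (t j - t i)\<^sup>2 * 1"
        using sq i by (intro mult_left_mono prod_le_1) auto
      finally show "(\<Prod>k\<in>J - {i}. (t k - t i)\<^sup>2) \<le> (t j - t i)\<^sup>2" by simp
      show "(\<Prod>l\<in>J - {i}. \<Prod>k\<in>J - {l}. (t k - t l)\<^sup>2) \<le> 1"
        using sq by (intro prod_le_1 conjI prod_nonneg) auto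
    qed (auto intro!: prod_nonneg)
    also have "(t j - t i)\<^sup>2 * 1 = ?d * ?d"
      by (simp add: power2_eq_square algebra_simps)
    also have "\<dots> \<le> ?d * 1"
      using t i j by (intro mult_left_mono) auto
    finally have "vandermonde4 J t \<le> ?d" by simp
    moreover have "vandermonde4 J t \<ge> 0"
      unfolding vandermonde4_def by (intro prod_nonneg) auto
    ultimately show "\<bar>vandermonde4 J t / (t i - t j)\<bar> \<le> 1"
      by (simp add: divide_le_eq_1)
  qed
  from cube_bounded_mult[OF h this] show ?thesis by simp
qed

text \<open>
  The logarithmic derivative remains correct at \<open>x = t j\<close>: there \<open>1 / 0 = 0\<close>, and the derivative
  vanishes because of the quadruple zero. Hence no exceptional null set appears later.
\<close>

lemma has_real_derivative_prod_power4:
  assumes "finite J"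
  shows "((\<lambda>x. \<Prod>j\<in>J. (x - t j) ^ 4) has_real_derivative
           4 * (\<Sum>j\<in>J. 1 / (x - t j)) * (\<Prod>j\<in>J. (x - t j) ^ 4)) (at x)"
  using assms
proof (induction J rule: finite_induct)
  case (insert i J)
  have eq: "4 * (x - t i) ^ 3 = 4 * (1 / (x - t i)) * (x - t i) ^ 4"
    by (cases "x = t i") (simp_all add: power_eq_if)
  have "((\<lambda>x. (x - t i) ^ 4) has_real_derivative 4 * (x - t i) ^ 3) (at x)"
    by (auto intro!: derivative_eq_intros)
  from DERIV_mult[OF this insert.IH] insert.hyps show ?case
    unfolding eq by (simp add: algebra_simps)
qed simp

text \<open>
  As a function of \<open>t i\<close> the integrand has the primitive \<open>p (t i) * q t * vandermonde4 (insert i J) t\<close>,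
  where \<open>vandermonde4 (insert i J)\<close> splits into \<open>\<Prod>\<^sub>j (t i - t j)^4\<close> and a factor free of \<open>t i\<close>. The
  right-hand side collects its values on the faces \<open>t i = 1\<close> and \<open>t i = 0\<close>.
\<close>

lemma loop_equation:
  assumes J: "finite J" "i \<notin> J"
    and p: "\<And>x. (p has_real_derivative p' x) (at x)" "continuous_on UNIV p'"
    and q: "cube_bounded (insert i J) q" "\<And>t x. q (t(i := x)) = q t"
  shows "cube_integral (insert i J)
           (\<lambda>t. (p' (t i) + 4 * p (t i) * (\<Sum>j\<in>J. 1 / (t i - t j))) * q t * vandermonde4 (insert i J) t)
       = cube_integral J
           (\<lambda>t. (p 1 * (\<Prod>j\<in>J. (1 - t j) ^ 4) - p 0 * (\<Prod>j\<in>J. t j ^ 4)) * q t * vandermonde4 J t)"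
    (is "cube_integral _ ?g = _")
proof -
  let ?f = "\<lambda>t. p (t i) * q t * vandermonde4 (insert i J) t"
  have V: "vandermonde4 (insert i J) (t(i := x))
      = vandermonde4 J t * (\<Prod>j\<in>J. (x - t j) ^ 4)" for t x
  proof -
    have "vandermonde4 J (t(i := x)) = vandermonde4 J t"
      using J by (intro vandermonde4_cong) auto
    moreover have "(\<Prod>j\<in>J. (x - (t(i := x)) j) ^ 4) = (\<Prod>j\<in>J. (x - t j) ^ 4)"
      using J by (intro prod.cong) auto
    ultimately show ?thesis
      using J by (simp add: vandermonde4_insert)
  qed
  have p_cont: "continuous_on UNIV p"
    using p(1) by (intro continuous_at_imp_continuous_on) (auto intro: DERIV_isCont)
  have "?g = (\<lambda>t. p' (t i) * q t * vandermonde4 (insert i J) t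
      + 4 * p (t i) * (\<Sum>j\<in>J. q t * vandermonde4 (insert i J) t / (t i - t j)))"
    by (simp add: fun_eq_iff algebra_simps sum_distrib_left sum_distrib_right)
  then have "cube_bounded (insert i J) ?g"
    using J p q(1) p_cont by (simp only:) (intro cube_bounded_intros; auto)
  moreover have "((\<lambda>x. ?f (t(i := x))) has_real_derivative ?g (t(i := x))) (at x)" for t x
  proof -
    have "(\<Sum>j\<in>J. 1 / (x - (t(i := x)) j)) = (\<Sum>j\<in>J. 1 / (x - t j))"
      using J by (intro sum.cong) auto
    moreover have "((\<lambda>x. q t * vandermonde4 J t * (p x * (\<Prod>j\<in>J. (x - t j) ^ 4))) has_real_derivative
        q t * vandermonde4 J t * (p' x * (\<Prod>j\<in>J. (x - t j) ^ 4)
          + 4 * (\<Sum>j\<in>J. 1 / (x - t j)) * (\<Prod>j\<in>J. (x - t j) ^ 4) * p x)) (at x)"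
      by (intro DERIV_cmult DERIV_mult p(1) has_real_derivative_prod_power4 J(1))
    ultimately show ?thesis
      by (simp add: V q(2) algebra_simps)
  qed
  ultimately have "cube_integral (insert i J) ?g
      = cube_integral J (\<lambda>t. ?f (t(i := 1)) - ?f (t(i := 0)))"
    using J by (intro cube_integral_partial_derivative)
  also have "\<dots> = cube_integral J
      (\<lambda>t. (p 1 * (\<Prod>j\<in>J. (1 - t j) ^ 4) - p 0 * (\<Prod>j\<in>J. t j ^ 4)) * q t * vandermonde4 J t)"
    by (intro cube_integral_cong) (simp add: V q(2) algebra_simps)
  finally show ?thesis .
qed

text \<open>
  Exchanging \<open>t i\<close> and \<open>t j\<close> changes only \<open>h\<close> and the sign of the denominator; adding the two
  forms of the integral gives the difference.
\<close>

lemma cube_integral_antisymmetrize: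
  assumes J: "finite J" "i \<in> J" "j \<in> J" "i \<noteq> j" and h: "cube_bounded J h"
  shows "2 * cube_integral J (\<lambda>t. h t * vandermonde4 J t / (t i - t j))
       = cube_integral J (\<lambda>t. (h t - h (swap_coords J i j t)) * vandermonde4 J t / (t i - t j))"
proof -
  let ?F = "\<lambda>t. h t * vandermonde4 J t / (t i - t j)"
  have F: "cube_bounded J ?F"
    using J h by (intro cube_bounded_intros)
  have sw: "?F (swap_coords J i j t) = - h (swap_coords J i j t) * vandermonde4 J t / (t i - t j)" for t
    using J divide_minus_right[of "h (swap_coords J i j t) * vandermonde4 J t" "t i - t j"]
    by (simp add: swap_coords_def vandermonde4_permute bij_betw_transpose)
  have "2 * cube_integral J ?F
      = cube_integral J ?F + cube_integral J (\<lambda>t. ?F (swap_coords J i j t))"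
    using J F by (subst cube_integral_swap) (auto intro: cube_bounded_measurable)
  also have "\<dots> = cube_integral J (\<lambda>t. ?F t + ?F (swap_coords J i j t))"
    using J F by (intro cube_integral_add[symmetric] cube_bounded_swap)
  also have "\<dots> = cube_integral J (\<lambda>t. (h t - h (swap_coords J i j t)) * vandermonde4 J t / (t i - t j))"
    unfolding sw by (intro cube_integral_cong) (simp add: diff_divide_distrib algebra_simps)
  finally show ?thesis .
qed

section \<open>Aomoto's recurrence\<close>

definition jacobi_weight :: "'i set \<Rightarrow> nat \<Rightarrow> nat \<Rightarrow> ('i \<Rightarrow> real) \<Rightarrow> real" where
  "jacobi_weight J a b t = (\<Prod>j\<in>J. t j ^ a * (1 - t j) ^ b) * vandermonde4 J t"

lemma prod_swap_coords:
  assumes "K \<subseteq> J" "i \<in> J" "j \<in> J" "i \<in> K \<longleftrightarrow> j \<in> K"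
  shows "(\<Prod>k\<in>K. f (swap_coords J i j t k)) = (\<Prod>k\<in>K. f (t k))"
proof -
  have "bij_betw (Transposition.transpose i j) K K"
    by (rule bij_betw_byWitness[where f'="Transposition.transpose i j"])
       (use assms in \<open>auto simp: Transposition.transpose_def\<close>)
  from prod.reindex_bij_betw[OF this, of "\<lambda>k. f (t k)"]
  have "(\<Prod>k\<in>K. f (t k)) = (\<Prod>k\<in>K. f (t (Transposition.transpose i j k)))" ..
  also have "\<dots> = (\<Prod>k\<in>K. f (swap_coords J i j t k))"
    using assms(1) by (intro prod.cong) (auto simp: swap_coords_def)
  finally show ?thesis ..
qed

lemma jacobi_weight_swap:
  "\<lbrakk>i \<in> J; j \<in> J\<rbrakk> \<Longrightarrow> jacobi_weight J a b (swap_coords J i j t) = jacobi_weight J a b t"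
  unfolding jacobi_weight_def
  by (subst prod_swap_coords)
     (simp_all add: swap_coords_def vandermonde4_permute bij_betw_transpose)

lemma cube_bounded_jacobi_weight [cube_bounded_intros]:
  "cube_bounded J (jacobi_weight J a b)"
  unfolding jacobi_weight_def by (intro cube_bounded_intros) auto

text \<open>Aomoto's generalisation of the Selberg integral, with an extra factor \<open>t\<^sub>k\<close> for each \<open>k\<close> in \<open>K\<close>.\<close>

definition aomoto_integral :: "'i set \<Rightarrow> nat \<Rightarrow> nat \<Rightarrow> 'i set \<Rightarrow> real" where
  "aomoto_integral J a b K = cube_integral J (\<lambda>t. (\<Prod>k\<in>K. t k) * jacobi_weight J a b t)"

text \<open>
  The loop equation for \<open>t\<^sub>i (1 - t\<^sub>i) (\<Prod>k\<in>K - {i}. t\<^sub>k)\<close> times the weight. The interaction with \<open>t\<^sub>j\<close>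
  is antisymmetrised. If \<open>j\<close> lies in \<open>K\<close>, then \<open>t\<^sub>i t\<^sub>j\<close> is a common factor and
  \<open>(1 - t\<^sub>i) - (1 - t\<^sub>j)\<close> cancels the denominator. If it does not, then
  \<open>t\<^sub>i (1 - t\<^sub>i) - t\<^sub>j (1 - t\<^sub>j) = (t\<^sub>i - t\<^sub>j) (1 - t\<^sub>i - t\<^sub>j)\<close> does, and \<open>t\<^sub>j\<close> has the same average as
  \<open>t\<^sub>i\<close>. There are \<open>k - 1\<close> indices of the first kind and \<open>n - k\<close> of the second.
\<close>

lemma aomoto_recurrence:
  assumes J: "finite J" and K: "K \<subseteq> J" and i: "i \<in> K"
  defines "k \<equiv> real (card K)" and "n \<equiv> real (card J)"
  shows "(real a + 1 + 2 * (n - k)) * aomoto_integral J a b (K - {i})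
       = (real a + real b + 2 + 2 * (k - 1) + 4 * (n - k)) * aomoto_integral J a b K"
proof -
  define I where "I = J - {i}"
  have I: "finite I" "i \<notin> I" "J = insert i I"
    using J K i by (auto simp: I_def)
  have finK: "finite K"
    using J K by (rule rev_finite_subset)
  let ?M = "\<lambda>t. \<Prod>k\<in>K - {i}. t k"
  let ?W = "jacobi_weight J a b"
  let ?w = "\<lambda>x::real. x ^ a * (1 - x) ^ b"
  define p where "p x = x ^ (a + 1) * (1 - x) ^ (b + 1)" for x :: real
  define p' where "p' x = ((a + 1) * (1 - x) - (b + 1) * x) * ?w x" for x :: real
  define q where "q t = ?M t * (\<Prod>j\<in>I. ?w (t j))" for t
  have prod_K: "(\<Prod>k\<in>K. t k) = t i * ?M t" for t :: "'a \<Rightarrow> real"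
    using finK i by (rule prod.remove)
  have W_eq: "?W t = ?w (t i) * (\<Prod>j\<in>I. ?w (t j)) * vandermonde4 J t" for t
    using I by (simp add: jacobi_weight_def)
  have bounds: "cube_bounded J (\<lambda>t. ?M t * ?W t)" "cube_bounded J (\<lambda>t. (\<Prod>k\<in>K. t k) * ?W t)"
    using K by (intro cube_bounded_intros; auto)+
  have loop: "cube_integral J (\<lambda>t. (p' (t i) + 4 * p (t i) * (\<Sum>j\<in>I. 1 / (t i - t j))) * q t * vandermonde4 J t) = 0"
  proof -
    have "(p has_real_derivative p' x) (at x)" for x
      unfolding p_def p'_def
      by (rule derivative_eq_intros refl)+ (simp add: algebra_simps)
    moreover have "continuous_on UNIV p'"
      unfolding p'_def by (intro continuous_intros)
    moreover have "cube_bounded (insert i I) q"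
      unfolding q_def using K I by (intro cube_bounded_intros) auto
    moreover have "q (t(i := x)) = q t" for t x
      unfolding q_def using I(2) by (intro arg_cong2[where f="(*)"] prod.cong) auto
    ultimately show ?thesis
      unfolding I(3) using I(1,2)
      by (subst loop_equation) (auto simp: p_def set_lebesgue_integral_def)
  qed
  \<comment> \<open>The interaction of the \<open>i\<close>-th and \<open>j\<close>-th coordinates, without its factor 4.\<close>
  define G where "G j t = t i * (1 - t i) * ?M t * ?W t / (t i - t j)" for j t
  have G_bounded: "cube_bounded J (G j)" if "j \<in> I" for j
  proof -
    have "G j = (\<lambda>t. t i * (1 - t i) * ?M t * (\<Prod>j\<in>J. ?w (t j)) * vandermonde4 J t / (t i - t j))"
      by (simp add: fun_eq_iff G_def jacobi_weight_def mult_ac)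
    then show ?thesis
      using that I K i by (auto intro!: cube_bounded_intros)
  qed
  have G_sym: "2 * cube_integral J (G j) = cube_integral J
      (\<lambda>t. (t i * (1 - t i) * ?M t - t j * (1 - t j) * ?M (swap_coords J i j t)) * ?W t / (t i - t j))"
    if j: "j \<in> I" for j
  proof -
    let ?h = "\<lambda>t. t i * (1 - t i) * ?M t * (\<Prod>j\<in>J. ?w (t j))"
    have iJ: "i \<in> J" "j \<in> J" "i \<noteq> j"
      using I j by auto
    have h: "cube_bounded J ?h"
      using iJ K by (intro cube_bounded_intros) auto
    have sw: "?h (swap_coords J i j t)
        = t j * (1 - t j) * ?M (swap_coords J i j t) * (\<Prod>j\<in>J. ?w (t j))" for t
      using iJ prod_swap_coords[where K=J and J=J and i=i and j=j and t=t and f="?w"]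
      by (simp add: swap_coords_def)
    have "G j = (\<lambda>t. ?h t * vandermonde4 J t / (t i - t j))"
      by (simp add: fun_eq_iff G_def jacobi_weight_def mult_ac)
    then have "2 * cube_integral J (G j)
        = cube_integral J (\<lambda>t. (?h t - ?h (swap_coords J i j t)) * vandermonde4 J t / (t i - t j))"
      using cube_integral_antisymmetrize[OF J iJ h] by simp
    also have "\<dots> = cube_integral J
      (\<lambda>t. (t i * (1 - t i) * ?M t - t j * (1 - t j) * ?M (swap_coords J i j t)) * ?W t / (t i - t j))"
      unfolding sw
      by (intro cube_integral_cong arg_cong2[where f="(/)"] refl) (simp add: jacobi_weight_def algebra_simps)
    finally show ?thesis .
  qed
  have G_in: "2 * cube_integral J (G j) = - aomoto_integral J a b K" if j: "j \<in> K - {i}" for j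
  proof -
    let ?N = "\<lambda>t. \<Prod>k\<in>K - {i} - {j}. t k"
    have iJ: "i \<in> J" "j \<in> J" "i \<noteq> j" "j \<in> I"
      using K i j by (auto simp: I_def)
    have M: "?M t = t j * ?N t" for t :: "'a \<Rightarrow> real"
      using finK j by (intro prod.remove) auto
    have "?N (swap_coords J i j t) = ?N t" for t
      using K iJ by (intro prod_swap_coords[where f="\<lambda>x. x"]) auto
    then have M': "?M (swap_coords J i j t) = t i * ?N t" for t
      using M[of "swap_coords J i j t"] iJ by (simp add: swap_coords_def)
    have "2 * cube_integral J (G j) = cube_integral J (\<lambda>t. - 1 * ((\<Prod>k\<in>K. t k) * ?W t))"
      unfolding G_sym[OF iJ(4)]
    proof (rule cube_integral_cong)
      fix t
      show "(t i * (1 - t i) * ?M t - t j * (1 - t j) * ?M (swap_coords J i j t)) * ?W t / (t i - t j)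
          = - 1 * ((\<Prod>k\<in>K. t k) * ?W t)"
      proof (cases "t i = t j")
        case True
        then have "?W t = 0"
          using vandermonde4_eq_0[OF J iJ(1-3), of t] by (simp add: jacobi_weight_def)
        then show ?thesis by simp
      next
        case False
        have "t i * (1 - t i) * ?M t - t j * (1 - t j) * ?M (swap_coords J i j t)
            = (t i - t j) * - (\<Prod>k\<in>K. t k)"
          unfolding prod_K M' M[of t] by (simp add: algebra_simps)
        with False show ?thesis by simp
      qed
    qed
    then show ?thesis
      by (simp add: aomoto_integral_def set_lebesgue_integral_def)
  qed
  have G_out: "2 * cube_integral J (G j) = aomoto_integral J a b (K - {i}) - 2 * aomoto_integral J a b K"
    if j: "j \<in> J - K" for j
  proof -
    have iJ: "i \<in> J" "j \<in> J" "i \<noteq> j" "j \<in> I"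
      using K i j by (auto simp: I_def)
    have M': "?M (swap_coords J i j t) = ?M t" for t
      using K iJ j by (intro prod_swap_coords[where f="\<lambda>x. x"]) auto
    let ?L = "\<lambda>t. t j * ?M t * ?W t"
    have L: "cube_bounded J ?L"
      using K iJ by (intro cube_bounded_intros) auto
    have "?L (swap_coords J i j t) = (\<Prod>k\<in>K. t k) * ?W t" for t
      unfolding M' jacobi_weight_swap[OF iJ(1,2)] prod_K using iJ by (simp add: swap_coords_def)
    then have L_int: "cube_integral J ?L = aomoto_integral J a b K"
      using cube_integral_swap[OF J iJ(1,2) cube_bounded_measurable[OF L]]
      by (simp add: aomoto_integral_def)
    have "2 * cube_integral J (G j)
        = cube_integral J (\<lambda>t. ?M t * ?W t - (\<Prod>k\<in>K. t k) * ?W t - ?L t)"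
      unfolding G_sym[OF iJ(4)]
    proof (rule cube_integral_cong)
      fix t
      show "(t i * (1 - t i) * ?M t - t j * (1 - t j) * ?M (swap_coords J i j t)) * ?W t / (t i - t j)
          = ?M t * ?W t - (\<Prod>k\<in>K. t k) * ?W t - ?L t"
      proof (cases "t i = t j")
        case True
        then have "?W t = 0"
          using vandermonde4_eq_0[OF J iJ(1-3), of t] by (simp add: jacobi_weight_def)
        then show ?thesis by simp
      next
        case False
        have "t i * (1 - t i) * ?M t - t j * (1 - t j) * ?M (swap_coords J i j t)
            = (t i - t j) * (1 - t i - t j) * ?M t"
          unfolding M' by (simp add: algebra_simps)
        with False have "(t i * (1 - t i) * ?M t - t j * (1 - t j) * ?M (swap_coords J i j t)) * ?W t / (t i - t j)
            = (1 - t i - t j) * ?M t * ?W t"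
          by simp
        then show ?thesis
          unfolding prod_K by (simp add: algebra_simps)
      qed
    qed
    also have "\<dots> = aomoto_integral J a b (K - {i}) - 2 * aomoto_integral J a b K"
      using J bounds L L_int
      by (simp add: cube_integral_diff cube_bounded_diff aomoto_integral_def)
    finally show ?thesis .
  qed
  have "(p' (t i) + 4 * p (t i) * (\<Sum>j\<in>I. 1 / (t i - t j))) * q t * vandermonde4 J t
      = (real a + 1) * (?M t * ?W t) - (real a + real b + 2) * ((\<Prod>k\<in>K. t k) * ?W t) + 4 * (\<Sum>j\<in>I. G j t)" for t
  proof -
    have "(\<Sum>j\<in>I. G j t) = t i * (1 - t i) * ?M t * ?W t * (\<Sum>j\<in>I. 1 / (t i - t j))"
      by (simp add: G_def sum_distrib_left)
    then show ?thesis
      unfolding prod_K W_eq p_def p'_def q_def by (simp add: algebra_simps)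
  qed
  then have "0 = cube_integral J (\<lambda>t. (real a + 1) * (?M t * ?W t) - (real a + real b + 2) * ((\<Prod>k\<in>K. t k) * ?W t)
      + 4 * (\<Sum>j\<in>I. G j t))"
    using loop by simp
  also have "\<dots> = (real a + 1) * aomoto_integral J a b (K - {i}) - (real a + real b + 2) * aomoto_integral J a b K
      + 4 * (\<Sum>j\<in>I. cube_integral J (G j))"
    using J I(1) G_bounded bounds
    by (simp add: cube_integral_add cube_integral_diff cube_integral_sum cube_bounded_intros
        aomoto_integral_def)
  also have "(\<Sum>j\<in>I. cube_integral J (G j))
      = (\<Sum>j\<in>K - {i}. cube_integral J (G j)) + (\<Sum>j\<in>J - K. cube_integral J (G j))"
  proof -
    have "I = (K - {i}) \<union> (J - K)"
      using K i by (auto simp: I_def)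
    then show ?thesis
      using J finK by (simp add: sum.union_disjoint[symmetric] Int_Diff disjoint_iff)
  qed
  also have "(\<Sum>j\<in>K - {i}. cube_integral J (G j)) = (k - 1) * (- aomoto_integral J a b K / 2)"
  proof -
    have "(\<Sum>j\<in>K - {i}. cube_integral J (G j)) = (\<Sum>j\<in>K - {i}. - aomoto_integral J a b K / 2)"
      using G_in by (intro sum.cong) (auto simp: field_simps)
    moreover have "card K \<ge> 1"
      using finK i by (auto simp: Suc_le_eq card_gt_0_iff)
    ultimately show ?thesis
      using finK i by (simp add: k_def card_Diff_singleton of_nat_diff)
  qed
  also have "(\<Sum>j\<in>J - K. cube_integral J (G j))
      = (n - k) * (aomoto_integral J a b (K - {i}) / 2 - aomoto_integral J a b K)"
  proof -
    have "(\<Sum>j\<in>J - K. cube_integral J (G j))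
        = (\<Sum>j\<in>J - K. aomoto_integral J a b (K - {i}) / 2 - aomoto_integral J a b K)"
      using G_out by (intro sum.cong) (auto simp: field_simps)
    then show ?thesis
      using J K finK by (simp add: k_def n_def card_Diff_subset of_nat_diff card_mono)
  qed
  finally show ?thesis
    by (simp add: field_simps)
qed

section \<open>Ratios of Selberg integrals\<close>

definition jacobi_integral :: "'i set \<Rightarrow> nat \<Rightarrow> nat \<Rightarrow> real" where
  "jacobi_integral J a b = cube_integral J (jacobi_weight J a b)"

lemma jacobi_integral_reflect:
  assumes "finite J"
  shows "jacobi_integral J a b = jacobi_integral J b a"
proof -
  have "vandermonde4 J (\<lambda>k\<in>J. 1 - t k) = vandermonde4 J t" for t
    unfolding vandermonde4_def by (intro prod.cong) (auto simp: power2_commute)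
  then have "jacobi_weight J a b (\<lambda>k\<in>J. 1 - t k) = jacobi_weight J b a t" for t
    by (simp add: jacobi_weight_def mult.commute)
  then show ?thesis
    using cube_integral_reflect[OF assms
        cube_bounded_measurable[OF cube_bounded_jacobi_weight[of J a b]]]
    by (simp add: jacobi_integral_def)
qed

lemma aomoto_integral_empty: "aomoto_integral J a b {} = jacobi_integral J a b"
  by (simp add: aomoto_integral_def jacobi_integral_def)

lemma aomoto_integral_full: "aomoto_integral J a b J = jacobi_integral J (a + 1) b"
  unfolding aomoto_integral_def jacobi_integral_def jacobi_weight_def
  by (simp add: prod.distrib mult_ac)

text \<open>
  \<open>K\<close> is built up one element at a time by the recurrence. The product of the denominators stays on
  the left; the subtractions are real ones.
\<close>

lemma aomoto_integral_formula:
  assumes J: "finite J" and K: "K \<subseteq> J"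
  defines "n \<equiv> real (card J)"
  shows "aomoto_integral J a b K * (\<Prod>l<card K. real a + real b + 2 + 2 * real l + 4 * (n - 1 - real l))
       = jacobi_integral J a b * (\<Prod>l<card K. real a + 1 + 2 * (n - 1 - real l))"
proof -
  have "finite K"
    using J K by (rule rev_finite_subset)
  then show ?thesis
    using K
  proof (induction K rule: finite_induct)
    case empty
    show ?case by (simp add: aomoto_integral_empty)
  next
    case (insert i K)
    let ?l = "real (card K)"
    have rec: "(real a + 1 + 2 * (n - 1 - ?l)) * aomoto_integral J a b K
        = (real a + real b + 2 + 2 * ?l + 4 * (n - 1 - ?l)) * aomoto_integral J a b (insert i K)"
      using aomoto_recurrence[OF J insert.prems, of i a b] insert.hyps
      by (simp add: n_def algebra_simps)
    let ?P = "\<lambda>k. \<Prod>l<k. real a + 1 + 2 * (n - 1 - real l)"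
    let ?Q = "\<lambda>k. \<Prod>l<k. real a + real b + 2 + 2 * real l + 4 * (n - 1 - real l)"
    have "aomoto_integral J a b (insert i K) * ?Q (card (insert i K))
        = ((real a + real b + 2 + 2 * ?l + 4 * (n - 1 - ?l)) * aomoto_integral J a b (insert i K)) * ?Q (card K)"
      using insert.hyps by (simp add: mult_ac)
    also have "\<dots> = (real a + 1 + 2 * (n - 1 - ?l)) * (aomoto_integral J a b K * ?Q (card K))"
      unfolding rec[symmetric] by (simp add: mult_ac)
    also have "\<dots> = (real a + 1 + 2 * (n - 1 - ?l)) * (jacobi_integral J a b * ?P (card K))"
      using insert by simp
    also have "\<dots> = jacobi_integral J a b * ?P (card (insert i K))"
      using insert.hyps by (simp add: mult_ac)
    finally show ?case .
  qed
qed

lemma jacobi_integral_shift: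
  assumes J: "finite J"
  defines "n \<equiv> card J"
  shows "jacobi_integral J (a + 1) b * (\<Prod>l<n. real a + real b + 2 + 2 * real l + 4 * (real n - 1 - real l))
       = jacobi_integral J a b * (\<Prod>l<n. real a + 1 + 2 * real l)"
proof -
  have "(\<Prod>l<n. real a + 1 + 2 * (real n - 1 - real l)) = (\<Prod>l<n. real a + 1 + 2 * real (n - Suc l))"
    by (intro prod.cong) (auto simp: of_nat_diff)
  also have "\<dots> = (\<Prod>l<n. real a + 1 + 2 * real l)"
    by (rule prod.nat_diff_reindex)
  finally show ?thesis
    using aomoto_integral_formula[OF J subset_refl, of a b]
    unfolding aomoto_integral_full n_def[symmetric] by (simp only:)
qed

text \<open>
  Both sides are reached from \<open>jacobi_integral J 2 0 = jacobi_integral J 0 2\<close> by raising the first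
  exponent twice. The denominators depend only on the sum of the exponents and so agree. The
  numerators \<open>\<Prod>(c + 2l)\<close> have \<open>c = 3, 4\<close> on the left and \<open>c = 1, 2\<close> on the right, and shifting \<open>c\<close> by
  2 changes such a product only by its last and first factors.
\<close>

lemma jacobi_integral_4_0:
  assumes J: "finite J"
  defines "n \<equiv> card J"
  shows "jacobi_integral J 4 0 = (real n + 1) * (2 * real n + 1) * jacobi_integral J 2 2"
proof -
  let ?S = "jacobi_integral J"
  let ?P = "\<lambda>c n. \<Prod>l<n. c + 2 * real l"
  let ?Q = "\<lambda>c. \<Prod>l<n. c + 2 * real l + 4 * (real n - 1 - real l)"
  have Q: "?Q c > 0" if "c > 0" for c
    using that by (intro prod_pos) (auto simp: add_pos_nonneg)
  have "?S 3 0 * ?Q 4 = ?S 2 0 * ?P 3 n" "?S 4 0 * ?Q 5 = ?S 3 0 * ?P 4 n"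
    "?S 1 2 * ?Q 4 = ?S 0 2 * ?P 1 n" "?S 2 2 * ?Q 5 = ?S 1 2 * ?P 2 n"
    using jacobi_integral_shift[OF J, of 2 0] jacobi_integral_shift[OF J, of 3 0]
      jacobi_integral_shift[OF J, of 0 2] jacobi_integral_shift[OF J, of 1 2]
    by (simp_all add: n_def numeral_eq_Suc)
  moreover have "?S 0 2 = ?S 2 0"
    by (rule jacobi_integral_reflect[OF J])
  ultimately have "?S 4 0 * (?Q 4 * ?Q 5) = ?S 2 0 * (?P 3 n * ?P 4 n)"
    "?S 2 2 * (?Q 4 * ?Q 5) = ?S 2 0 * (?P 1 n * ?P 2 n)"
    by algebra+
  moreover have "?P 3 n * ?P 4 n = (real n + 1) * (2 * real n + 1) * (?P 1 n * ?P 2 n)"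
  proof -
    have "?P 3 n = (2 * real n + 1) * ?P 1 n"
      by (induction n) (auto simp: algebra_simps)
    moreover have "?P 4 n = (real n + 1) * ?P 2 n"
      by (induction n) (auto simp: algebra_simps)
    ultimately show ?thesis by simp
  qed
  ultimately have "?S 4 0 * (?Q 4 * ?Q 5) = (real n + 1) * (2 * real n + 1) * ?S 2 2 * (?Q 4 * ?Q 5)"
    by algebra
  with Q[of 4] Q[of 5] show ?thesis
    by simp
qed

lemma AE_component_neq:
  assumes "finite J"
  shows "AE t in (\<Pi>\<^sub>M j\<in>J. lborel). \<forall>j\<in>J. t j \<noteq> (c :: real)"
proof -
  interpret product_sigma_finite "\<lambda>_. lborel :: real measure"
    by (rule product_sigma_finite_lborel)
  let ?M = "\<Pi>\<^sub>M j\<in>J. (lborel :: real measure)"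
  have "AE t in ?M. t j \<noteq> c" if j: "j \<in> J" for j
  proof (rule AE_I')
    let ?N = "\<Pi>\<^sub>E k\<in>J. if k = j then {c} else UNIV"
    have "emeasure ?M ?N = (\<Prod>k\<in>J. emeasure lborel (if k = j then {c} else UNIV))"
      using assms by (intro emeasure_PiM) auto
    also have "\<dots> = 0"
      using assms j by (intro prod_zero bexI[of _ j]) auto
    finally show "?N \<in> null_sets ?M"
      using assms by (intro null_setsI sets_PiM_I_finite) auto
    show "{t \<in> space ?M. \<not> t j \<noteq> c} \<subseteq> ?N"
      by (auto simp: space_PiM PiE_iff extensional_def)
  qed
  then show ?thesis
    using assms by (simp add: AE_finite_all)
qed

text \<open>
  Real and natural powers agree at positive bases, while \<open>0 powr 0 = 0\<close> differs from \<open>0 ^ 0 = 1\<close>; the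
  integrands can therefore differ where some \<open>t j\<close> is 0 or 1, which is a null set.
\<close>

lemma selberg_integral_eq_jacobi_integral:
  "selberg_integral n (real a + 1) (real b + 1) 2 = jacobi_integral {1..n} a b"
proof -
  let ?J = "{1..n}"
  let ?f = "\<lambda>t. (\<Prod>j=1..n. t j powr (real a + 1 - 1) * (1 - t j) powr (real b + 1 - 1))
      * \<bar>vandermonde n t\<bar> powr (2 * 2)"
  have [measurable]: "vandermonde n \<in> borel_measurable (lborel_pow n)"
    unfolding vandermonde_def by (intro borel_measurable_prod) (auto simp: measurable_split_conv)
  have f: "?f \<in> borel_measurable (lborel_pow n)"
    by measurable
  have "?f t = jacobi_weight ?J a b t"
    if t: "t \<in> unit_cube n" "\<forall>j\<in>?J. t j \<noteq> 0" "\<forall>j\<in>?J. t j \<noteq> 1" for t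
  proof -
    have "t j powr (real a + 1 - 1) * (1 - t j) powr (real b + 1 - 1) = t j ^ a * (1 - t j) ^ b"
      if j: "j \<in> ?J" for j
    proof -
      have "0 \<le> t j" "t j \<le> 1" "t j \<noteq> 0" "t j \<noteq> 1"
        using t j by (auto simp: PiE_iff)
      then show ?thesis
        by (simp add: powr_realpow)
    qed
    moreover have "\<bar>vandermonde n t\<bar> powr (2 * 2) = vandermonde4 ?J t"
      by (cases "vandermonde n t = 0") (simp_all add: vandermonde_power4[symmetric] del: One_nat_def)
    ultimately show ?thesis
      by (simp add: jacobi_weight_def)
  qed
  then have "AE t in lborel_pow n. indicator (unit_cube n) t *\<^sub>R ?f t
      = indicator (unit_cube n) t *\<^sub>R jacobi_weight ?J a b t"
    using AE_component_neq[of ?J 0] AE_component_neq[of ?J 1]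
    by (auto elim!: AE_mp split: split_indicator)
  then show ?thesis
    unfolding selberg_integral_def jacobi_integral_def set_lebesgue_integral_def
    using f cube_bounded_measurable[OF cube_bounded_jacobi_weight]
    by (intro integral_cong_AE borel_measurable_scaleR borel_measurable_indicator sets_cube) auto
qed

section \<open>The two identities\<close>

text \<open>
  The loop equation with \<open>p x = x ^ a\<close> and \<open>q\<close> the product of the remaining \<open>a\<close>-th powers. Here
  \<open>p (t i) * q t\<close> is symmetric, so every interaction term is its own negative. The face \<open>t i = 0\<close>
  gives nothing; on \<open>t i = 1\<close> the factors \<open>(1 - t j)^4\<close> come from the Vandermonde product. The bound
  \<open>2 \<le> a\<close> makes \<open>inverse x * x ^ a = x ^ (a - 1)\<close> true at \<open>x = 0\<close> as well.
\<close>

lemma jacobi_integral_inverse_moment: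
  assumes I: "finite I" "i \<notin> I" and a: "a \<ge> 2"
  shows "a * cube_integral (insert i I) (\<lambda>t. inverse (t i) * jacobi_weight (insert i I) a 0 t)
       = jacobi_integral I a 4"
proof -
  let ?J = "insert i I"
  let ?W = "jacobi_weight ?J a 0"
  define p where "p x = x ^ a" for x :: real
  define p' where "p' x = a * x ^ (a - 1)" for x :: real
  define q where "q t = (\<Prod>j\<in>I. t j ^ a)" for t :: "'a \<Rightarrow> real"
  have W: "?W t = t i ^ a * q t * vandermonde4 ?J t" for t
    using I by (simp add: jacobi_weight_def q_def)
  have qb: "cube_bounded ?J q"
    unfolding q_def by (intro cube_bounded_intros) auto
  have q_upd: "q (t(i := x)) = q t" for t x
    unfolding q_def using I by (intro prod.cong) auto
  have p'_eq: "p' x = a * (inverse x * x ^ a)" for x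
    using a by (cases "x = 0"; cases a) (auto simp: p'_def)
  have loop: "cube_integral ?J (\<lambda>t. (p' (t i) + 4 * p (t i) * (\<Sum>j\<in>I. 1 / (t i - t j))) * q t * vandermonde4 ?J t)
      = cube_integral I (\<lambda>t. (p 1 * (\<Prod>j\<in>I. (1 - t j) ^ 4) - p 0 * (\<Prod>j\<in>I. t j ^ 4)) * q t * vandermonde4 I t)"
  proof (rule loop_equation[OF I _ _ qb q_upd])
    show "(p has_real_derivative p' x) (at x)" for x
      unfolding p_def p'_def using a by (auto intro!: derivative_eq_intros)
    show "continuous_on UNIV p'"
      unfolding p'_def by (intro continuous_intros)
  qed
  let ?G = "\<lambda>j t. ?W t / (t i - t j)"
  let ?h = "\<lambda>t. \<Prod>j\<in>?J. t j ^ a"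
  have h: "cube_bounded ?J ?h"
    by (intro cube_bounded_intros) auto
  have G_eq: "?G j = (\<lambda>t. ?h t * vandermonde4 ?J t / (t i - t j))" for j
    by (simp add: jacobi_weight_def)
  have G: "cube_bounded ?J (?G j)" "cube_integral ?J (?G j) = 0" if j: "j \<in> I" for j
  proof -
    have iJ: "finite ?J" "i \<in> ?J" "j \<in> ?J" "i \<noteq> j"
      using I j by auto
    show "cube_bounded ?J (?G j)"
      unfolding G_eq using iJ h by (intro cube_bounded_intros)
    have "?h (swap_coords ?J i j t) = ?h t" for t
      using iJ by (intro prod_swap_coords[where f="\<lambda>x. x ^ a"]) auto
    then have "2 * cube_integral ?J (?G j) = 0"
      unfolding G_eq cube_integral_antisymmetrize[OF iJ h]
      by (simp add: set_lebesgue_integral_def)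
    then show "cube_integral ?J (?G j) = 0" by simp
  qed
  have main: "cube_bounded ?J (\<lambda>t. p' (t i) * q t * vandermonde4 ?J t)"
    unfolding p'_def using qb by (intro cube_bounded_intros) auto
  have "a * cube_integral ?J (\<lambda>t. inverse (t i) * ?W t)
      = cube_integral ?J (\<lambda>t. p' (t i) * q t * vandermonde4 ?J t)"
    unfolding set_integral_mult_right[symmetric] W p'_eq
    by (intro cube_integral_cong) (simp add: mult_ac)
  also have "\<dots> = cube_integral ?J (\<lambda>t. p' (t i) * q t * vandermonde4 ?J t + 4 * (\<Sum>j\<in>I. ?G j t))"
    using I G main
    by (simp add: cube_integral_add cube_integral_sum cube_bounded_intros)
  also have "\<dots> = cube_integral ?J
      (\<lambda>t. (p' (t i) + 4 * p (t i) * (\<Sum>j\<in>I. 1 / (t i - t j))) * q t * vandermonde4 ?J t)"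
  proof (rule cube_integral_cong)
    fix t
    have "(\<Sum>j\<in>I. ?G j t) = ?W t * (\<Sum>j\<in>I. 1 / (t i - t j))"
      by (simp add: sum_distrib_left)
    then show "p' (t i) * q t * vandermonde4 ?J t + 4 * (\<Sum>j\<in>I. ?G j t)
        = (p' (t i) + 4 * p (t i) * (\<Sum>j\<in>I. 1 / (t i - t j))) * q t * vandermonde4 ?J t"
      by (simp add: W p_def algebra_simps)
  qed
  also have "\<dots> = jacobi_integral I a 4"
    unfolding loop jacobi_integral_def using a
    by (intro cube_integral_cong) (simp add: p_def q_def jacobi_weight_def prod.distrib mult_ac)
  finally show ?thesis .
qed

theorem theorem8p1:
  fixes m :: nat
  assumes "m \<ge> 1"
  shows "(LINT t:unit_cube m|lborel_pow m.
            sum_inverse m t * (\<Prod>j=1..m. (t j)\<^sup>2 * (1 - t j)\<^sup>2) * (vandermonde m t) ^ 4)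
         = (selberg_integral m 5 1 2 - selberg_integral m 3 3 2) / 2 \<and>
         (LINT t:unit_cube m|lborel_pow m.
            sum_inverse m t * (\<Prod>j=1..m. (t j)\<^sup>2) * (vandermonde m t) ^ 4)
         = real m / 2 * selberg_integral (m - 1) 5 3 2"
proof
  let ?J = "{1..m}"
  have selberg: "selberg_integral m 5 1 2 = jacobi_integral ?J 4 0"
    "selberg_integral m 3 3 2 = jacobi_integral ?J 2 2"
    using selberg_integral_eq_jacobi_integral[of m 4 0] selberg_integral_eq_jacobi_integral[of m 2 2]
    by simp_all
  \<comment> \<open>For \<open>K = ?J\<close> and exponents \<open>(1, 2)\<close>, one side of the recurrence lacks the factor \<open>t j\<close> from
    the weight with exponents \<open>(2, 2)\<close>, which is the same as multiplying by \<open>inverse (t j)\<close>.\<close>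
  have summand: "aomoto_integral ?J 1 2 (?J - {j}) = (2 * real m + 3) / 2 * jacobi_integral ?J 2 2"
    if "j \<in> ?J" for j
  proof -
    have "2 * aomoto_integral ?J 1 2 (?J - {j}) = (2 * real m + 3) * aomoto_integral ?J 1 2 ?J"
      using aomoto_recurrence[of ?J ?J j 1 2] that by (simp add: algebra_simps)
    then show ?thesis
      by (simp add: aomoto_integral_full numeral_eq_Suc)
  qed
  have "(LINT t:unit_cube m|lborel_pow m.
      sum_inverse m t * (\<Prod>j=1..m. (t j)\<^sup>2 * (1 - t j)\<^sup>2) * (vandermonde m t) ^ 4)
      = cube_integral ?J (\<lambda>t. \<Sum>j\<in>?J. (\<Prod>k\<in>?J - {j}. t k) * jacobi_weight ?J 1 2 t)"
  proof (rule cube_integral_cong)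
    fix t :: "nat \<Rightarrow> real"
    have "inverse (t j) * (\<Prod>k\<in>?J. (t k)\<^sup>2 * (1 - t k)\<^sup>2)
        = (\<Prod>k\<in>?J - {j}. t k) * (\<Prod>k\<in>?J. t k * (1 - t k)\<^sup>2)" if "j \<in> ?J" for j
    proof -
      have "(\<Prod>k\<in>?J. (t k)\<^sup>2 * (1 - t k)\<^sup>2) = (\<Prod>k\<in>?J. t k) * (\<Prod>k\<in>?J. t k * (1 - t k)\<^sup>2)"
        by (simp add: power2_eq_square prod.distrib mult_ac)
      moreover have "(\<Prod>k\<in>?J. t k) = t j * (\<Prod>k\<in>?J - {j}. t k)"
        using that by (intro prod.remove) auto
      moreover have "(\<Prod>k\<in>?J. t k * (1 - t k)\<^sup>2) = 0" if "t j = 0"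
        using that \<open>j \<in> ?J\<close> by (intro prod_zero) auto
      ultimately show ?thesis
        by (cases "t j = 0") auto
    qed
    then show "sum_inverse m t * (\<Prod>j=1..m. (t j)\<^sup>2 * (1 - t j)\<^sup>2) * (vandermonde m t) ^ 4
        = (\<Sum>j\<in>?J. (\<Prod>k\<in>?J - {j}. t k) * jacobi_weight ?J 1 2 t)"
      unfolding sum_inverse_def jacobi_weight_def vandermonde_power4 sum_distrib_right
      by (intro sum.cong) (simp_all flip: mult.assoc)
  qed
  also have "\<dots> = (\<Sum>j\<in>?J. aomoto_integral ?J 1 2 (?J - {j}))"
    unfolding aomoto_integral_def
    by (intro cube_integral_sum cube_bounded_intros) auto
  also have "\<dots> = (\<Sum>j\<in>?J. (2 * real m + 3) / 2 * jacobi_integral ?J 2 2)"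
    by (intro sum.cong refl summand)
  also have "\<dots> = m * ((2 * real m + 3) / 2 * jacobi_integral ?J 2 2)"
    by simp
  also have "\<dots> = (selberg_integral m 5 1 2 - selberg_integral m 3 3 2) / 2"
    unfolding selberg using jacobi_integral_4_0[of ?J] by (simp add: field_simps)
  finally show "(LINT t:unit_cube m|lborel_pow m.
      sum_inverse m t * (\<Prod>j=1..m. (t j)\<^sup>2 * (1 - t j)\<^sup>2) * (vandermonde m t) ^ 4)
      = (selberg_integral m 5 1 2 - selberg_integral m 3 3 2) / 2" .
next
  let ?J = "{1..m}" and ?I = "{1..m - 1}"
  let ?W = "jacobi_weight ?J 2 0"
  have J: "?J = insert m ?I" "m \<notin> ?I"
    using assms by auto
  have W: "cube_bounded ?J (\<lambda>t. inverse (t j) * ?W t)" if j: "j \<in> ?J" for j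
  proof -
    have "inverse (t j) * ?W t = t j * (\<Prod>k\<in>?J - {j}. (t k)\<^sup>2) * vandermonde4 ?J t" for t
      using j unfolding jacobi_weight_def
      by (subst prod.remove[of ?J j]) (auto simp: power2_eq_square)
    then show ?thesis
      using j by (simp only:) (intro cube_bounded_intros; auto)
  qed
  \<comment> \<open>By symmetry the distinguished index may be taken to be the last one, which leaves \<open>{1..m - 1}\<close>.\<close>
  have summand: "cube_integral ?J (\<lambda>t. inverse (t j) * ?W t) = jacobi_integral ?I 2 4 / 2" if j: "j \<in> ?J" for j
  proof -
    have m: "m \<in> ?J" using assms by simp
    have "inverse (swap_coords ?J j m t j) * ?W (swap_coords ?J j m t) = inverse (t m) * ?W t" for t
      using jacobi_weight_swap[OF j m] j by (simp add: swap_coords_def)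
    then have "cube_integral ?J (\<lambda>t. inverse (t j) * ?W t) = cube_integral ?J (\<lambda>t. inverse (t m) * ?W t)"
      using cube_integral_swap[OF _ j m cube_bounded_measurable[OF W[OF j]]] by simp
    also have "2 * \<dots> = jacobi_integral ?I 2 4"
      using jacobi_integral_inverse_moment[of ?I m 2] J by simp
    finally show ?thesis by simp
  qed
  have "(LINT t:unit_cube m|lborel_pow m.
      sum_inverse m t * (\<Prod>j=1..m. (t j)\<^sup>2) * (vandermonde m t) ^ 4)
      = cube_integral ?J (\<lambda>t. \<Sum>j\<in>?J. inverse (t j) * ?W t)"
    by (intro cube_integral_cong)
       (simp add: sum_inverse_def jacobi_weight_def vandermonde_power4 sum_distrib_right mult.assoc)
  also have "\<dots> = (\<Sum>j\<in>?J. cube_integral ?J (\<lambda>t. inverse (t j) * ?W t))"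
    using W by (intro cube_integral_sum) auto
  also have "\<dots> = (\<Sum>j\<in>?J. jacobi_integral ?I 2 4 / 2)"
    by (intro sum.cong refl summand)
  also have "\<dots> = real m / 2 * jacobi_integral ?I 2 4"
    by simp
  also have "\<dots> = real m / 2 * selberg_integral (m - 1) 5 3 2"
    using jacobi_integral_reflect[of ?I 2 4] selberg_integral_eq_jacobi_integral[of "m - 1" 4 2] by simp
  finally show "(LINT t:unit_cube m|lborel_pow m.
      sum_inverse m t * (\<Prod>j=1..m. (t j)\<^sup>2) * (vandermonde m t) ^ 4)
      = real m / 2 * selberg_integral (m - 1) 5 3 2" .
qed

end
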